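(* Let $d \geq 1$. There is no tiling of $\mathbb{Z}^d$ by Cartesian cosets in which no two of the tiles are translates of one another. Equivalently: if $\mathbb{Z}^d$ is the disjoint union of finitely many Cartesian cosets $T_1, \dots, T_n$ with $n \geq 2$, then there exist $i \neq j$ such that $T_j = \mathbf{w} + T_i$ for some $\mathbf{w} \in \mathbb{Z}^d$.
   Context: A Cartesian coset in $\mathbb{Z}^d$ is a set of the form $\mathbf{v} + L$ where $\mathbf{v} \in \mathbb{Z}^d$ and $L = a_1\mathbb{Z} \times \cdots \times a_d\mathbb{Z}$ for positive integers $a_1, \dots, a_d$ (i.e., a Cartesian product of $d$ arithmetic progressions with positive common differences). A tiling of a set $S$ is a nontrivial (at least two members) finite family of pairwise disjoint sets whose union is $S$; its members are called tiles. *)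

theory Defs
  imports "HOL-Analysis.Analysis"
begin

text \<open>\<open>\<int>\<^sup>d\<close> is the type \<open>int ^ 'd\<close> over a finite index type, with \<open>d = CARD('d)\<close>;
  index types are nonempty, so \<open>d \<ge> 1\<close> is built in.\<close>

definition cartesian_lattice :: "int ^ 'd \<Rightarrow> (int ^ 'd) set" where
  "cartesian_lattice a = {x. \<forall>i. x $ i \<in> range (\<lambda>k. a $ i * k)}"

definition cartesian_coset :: "(int ^ 'd) set \<Rightarrow> bool" where
  "cartesian_coset T \<longleftrightarrow>
     (\<exists>v a. (\<forall>i. a $ i > 0) \<and> T = (\<lambda>x. v + x) ` cartesian_lattice a)"

definition tiling :: "'a set set \<Rightarrow> 'a set \<Rightarrow> bool" where
  "tiling \<T> S \<longleftrightarrow> finite \<T> \<and> card \<T> \<ge> 2 \<and> disjoint \<T> \<and> \<Union>\<T> = S"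

definition is_translate :: "'a::plus set \<Rightarrow> 'a set \<Rightarrow> bool" where
  "is_translate T T' \<longleftrightarrow> (\<exists>w. T' = (\<lambda>x. w + x) ` T)"

end

theory Submission
  imports Defs "HOL-Library.Real_Mod"
begin

text \<open>A nonzero multiple of a character \<open>\<psi>\<close> is not a finite sum of functions each of which has a
  period \<open>h\<close> with \<open>\<psi> h \<noteq> 1\<close>: the difference operator \<open>f \<mapsto> f (\<cdot> + h) - f\<close> kills one summand and only
  rescales \<open>\<psi>\<close>. Given a tile with differences \<open>a\<close>, let \<open>\<psi> x = exp (2 \<pi> \<i> \<Sum>\<^sub>i x\<^sub>i / a\<^sub>i)\<close>. As \<open>\<psi>\<close> is
  constant on the tile, it is a combination of translates of the indicator of the tile, which is
  \<open>1\<close> minus the indicators of the other tiles. Hence \<open>\<psi>\<close> must be \<open>1\<close> on every period of some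
  other tile, which means that \<open>a\<close> divides the differences of that tile. If \<open>a\<close> is maximal, the two
  tiles have the same differences and are translates of each other.\<close>

lemma scaled_character_sum_periodic_eq_0:
  fixes \<psi> :: "'a::ab_semigroup_add \<Rightarrow> 'b::idom"
  assumes "finite I"
    and character: "\<And>x y. \<psi> (x + y) = \<psi> x * \<psi> y"
    and nontrivial: "\<And>k. k \<in> I \<Longrightarrow> \<psi> (h k) \<noteq> 1"
    and periodic: "\<And>k x. k \<in> I \<Longrightarrow> f k (x + h k) = f k x"
    and sum: "\<And>x. c * \<psi> x = (\<Sum>k\<in>I. f k x)"
  shows "c * \<psi> x = 0"
  using assms(1) nontrivial periodic sum
proof (induction I arbitrary: c f x)
  case empty
  then show ?case by simp
next
  case (insert k I)
  have "c * (\<psi> (h k) - 1) * \<psi> x = 0"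
  proof (rule insert.IH[where f = "\<lambda>l x. f l (x + h k) - f l x"])
    fix l x assume "l \<in> I"
    then have "f l (x + h l) = f l x" "f l (x + h k + h l) = f l (x + h k)"
      using insert.prems(2) by auto
    then show "f l (x + h l + h k) - f l (x + h l) = f l (x + h k) - f l x"
      by (simp add: add_ac)
  next
    fix x
    have "c * (\<psi> (h k) - 1) * \<psi> x = c * \<psi> (x + h k) - c * \<psi> x"
      by (simp add: character algebra_simps)
    also have "\<dots> = (\<Sum>l\<in>I. f l (x + h k) - f l x)"
      using insert.hyps insert.prems(2)[of k x] unfolding insert.prems(3)
      by (simp add: sum_subtractf)
    finally show "c * (\<psi> (h k) - 1) * \<psi> x = (\<Sum>l\<in>I. f l (x + h k) - f l x)" .
  qed (use insert.prems(1) in auto)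
  then show ?case
    using insert.prems(1)[of k] by auto
qed

lemma character_eq_sum_translated_indicator:
  fixes \<psi> :: "'a::ab_group_add \<Rightarrow> 'b::comm_semiring_1"
  assumes character: "\<And>x y. \<psi> (x + y) = \<psi> x * \<psi> y"
    and const: "\<And>t. t \<in> T \<Longrightarrow> \<psi> t = c"
    and "finite R" and transversal: "\<exists>!r. r \<in> R \<and> x - r \<in> T"
  shows "\<psi> x = (\<Sum>r\<in>R. c * \<psi> r * indicator T (x - r))"
proof -
  obtain r where r: "x - r \<in> T" "R \<inter> {s. x - s \<in> T} = {r}"
    using transversal by blast
  have "(\<Sum>s\<in>R. c * \<psi> s * indicator T (x - s)) = c * \<psi> r"
    using \<open>finite R\<close> r(2) by (simp add: indicator_def)
  also have "\<dots> = \<psi> (x - r) * \<psi> r"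
    using const r(1) by simp
  also have "\<dots> = \<psi> x"
    by (simp flip: character)
  finally show ?thesis ..
qed

lemma indicator_partition_member:
  assumes "finite I" "disjoint_family_on T I" "x \<in> (\<Union>k\<in>I. T k)" "m \<in> I"
  shows "(indicator (T m) x :: 'b::ring_1) = (\<Sum>k\<in>I. if k = m then 1 else - indicator (T k) x)"
proof -
  have "(1 :: 'b) = (\<Sum>k\<in>I. indicator (T k) x)"
    using indicator_UN_disjoint[OF assms(1,2), of x] assms(3) by simp
  also have "\<dots> = indicator (T m) x + (\<Sum>k\<in>I - {m}. indicator (T k) x)"
    using assms(1,4) by (rule sum.remove)
  finally show ?thesis
    using assms(1,4) by (simp add: sum.remove[of I m] sum_negf algebra_simps)
qed

theorem partition_character_trivial_on_some_period:
  fixes T :: "'i \<Rightarrow> 'a::ab_group_add set" and \<psi> :: "'a \<Rightarrow> 'b::idom"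
  assumes partition: "finite I" "disjoint_family_on T I" "(\<Union>k\<in>I. T k) = UNIV"
    and m: "m \<in> I" "I \<noteq> {m}"
    and character: "\<And>x y. \<psi> (x + y) = \<psi> x * \<psi> y" "\<psi> 0 = 1"
    and const: "\<And>t. t \<in> T m \<Longrightarrow> \<psi> t = c"
    and transversal: "finite R" "\<And>x. \<exists>!r. r \<in> R \<and> x - r \<in> T m"
    and periods: "\<And>k x. k \<in> I - {m} \<Longrightarrow> x + h k \<in> T k \<longleftrightarrow> x \<in> T k"
  shows "\<exists>k\<in>I - {m}. \<psi> (h k) = 1"
proof (rule ccontr)
  assume no_trivial: "\<not> ?thesis"
  obtain l where l: "l \<in> I - {m}"
    using m by blast
  \<comment> \<open>The constant \<open>1\<close> that takes the place of tile \<open>m\<close> has every period, in particular \<open>h l\<close>.\<close>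
  define p where "p k = (if k = m then h l else h k)" for k
  define g :: "'i \<Rightarrow> 'a \<Rightarrow> 'b" where
    "g k x = (if k = m then 1 else - indicator (T k) x)" for k x
  have indicator: "indicator (T m) x = (\<Sum>k\<in>I. g k x)" for x
    unfolding g_def using partition m(1) by (intro indicator_partition_member) auto
  define f where "f k x = (\<Sum>r\<in>R. c * \<psi> r * g k (x - r))" for k x
  have "1 * \<psi> 0 = 0"
  proof (rule scaled_character_sum_periodic_eq_0[where \<psi> = \<psi> and f = f and h = p,
        OF partition(1) character(1)])
    show "\<psi> (p k) \<noteq> 1" if "k \<in> I" for k
      using no_trivial that l by (auto simp: p_def)
    have "g k (x + p k) = g k x" if "k \<in> I" for k x
      using that periods[of k x] by (simp add: g_def p_def indicator_def)
    then show "f k (x + p k) = f k x" if "k \<in> I" for k x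
      using that by (simp add: f_def flip: diff_add_eq)
    show "1 * \<psi> x = (\<Sum>k\<in>I. f k x)" for x
    proof -
      have "\<psi> x = (\<Sum>r\<in>R. c * \<psi> r * indicator (T m) (x - r))"
        using character(1) const transversal by (rule character_eq_sum_translated_indicator)
      also have "\<dots> = (\<Sum>r\<in>R. \<Sum>k\<in>I. c * \<psi> r * g k (x - r))"
        by (simp only: indicator sum_distrib_left)
      also have "\<dots> = (\<Sum>k\<in>I. f k x)"
        unfolding f_def by (rule sum.swap)
      finally show ?thesis
        by simp
    qed
  qed
  then show False
    using character(2) by simp
qed

lemma mem_cartesian_lattice_iff: "x \<in> cartesian_lattice a \<longleftrightarrow> (\<forall>i. a $ i dvd x $ i)"
  by (auto simp: cartesian_lattice_def dvd_def)

lemma mem_translate_cartesian_lattice_iff: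
  "x \<in> (+) v ` cartesian_lattice a \<longleftrightarrow> (\<forall>i. a $ i dvd x $ i - v $ i)"
proof -
  have "x \<in> (+) v ` cartesian_lattice a \<longleftrightarrow> x - v \<in> cartesian_lattice a"
    by (auto simp: image_iff intro!: bexI[of _ "x - v"])
  then show ?thesis
    by (simp add: mem_cartesian_lattice_iff)
qed

lemma add_axis_mem_translate_cartesian_lattice_iff:
  "x + axis j (a $ j) \<in> (+) v ` cartesian_lattice a \<longleftrightarrow>
     x \<in> (+) v ` cartesian_lattice a"
proof -
  have "(x + axis j (a $ j)) $ i - v $ i = (x $ i - v $ i) + axis j (a $ j) $ i" for i
    by simp
  moreover have "a $ i dvd axis j (a $ j) $ i" for i
    by (simp add: axis_def)
  ultimately show ?thesis
    by (simp only: mem_translate_cartesian_lattice_iff dvd_add_left_iff)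
qed

definition fundamental_box :: "int ^ 'd \<Rightarrow> (int ^ 'd) set" where
  "fundamental_box a = {r. \<forall>i. r $ i \<in> {0..<a $ i}}"

lemma finite_fundamental_box: "finite (fundamental_box a)"
proof -
  have "fundamental_box a = vec_nth -` (\<Pi>\<^sub>E i\<in>UNIV. {0..<a $ i})"
    by (auto simp: fundamental_box_def PiE_iff)
  then show ?thesis
    by (simp add: finite_vimageI finite_PiE inj_def vec_nth_inject)
qed

lemma fundamental_box_transversal:
  assumes pos: "\<And>i. a $ i > 0"
  shows "\<exists>!r. r \<in> fundamental_box a \<and> x - r \<in> (+) v ` cartesian_lattice a"
proof -
  have "r \<in> fundamental_box a \<and> x - r \<in> (+) v ` cartesian_lattice a
      \<longleftrightarrow> r = (\<chi> i. (x $ i - v $ i) mod a $ i)" (is "?P \<longleftrightarrow> _") for r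
  proof -
    have "x $ i - r $ i - v $ i = x $ i - v $ i - r $ i" for i
      by simp
    then have "?P \<longleftrightarrow> (\<forall>i. r $ i \<in> {0..<a $ i} \<and> a $ i dvd x $ i - v $ i - r $ i)"
      by (simp only: fundamental_box_def mem_Collect_eq mem_translate_cartesian_lattice_iff
          vector_minus_component all_conj_distrib)
    also have "\<dots> \<longleftrightarrow> (\<forall>i. r $ i = (x $ i - v $ i) mod a $ i)"
      using pos by (intro iff_allI) (auto simp flip: mod_eq_dvd_iff)
    finally show ?thesis
      by (simp add: vec_eq_iff)
  qed
  then show ?thesis
    by simp
qed

definition cartesian_character :: "int ^ 'd \<Rightarrow> int ^ 'd \<Rightarrow> complex" where
  "cartesian_character a x = cis (2 * pi * (\<Sum>i\<in>UNIV. of_int (x $ i) / of_int (a $ i)))"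

lemma cartesian_character_0: "cartesian_character a 0 = 1"
  by (simp add: cartesian_character_def)

lemma cartesian_character_add:
  "cartesian_character a (x + y) = cartesian_character a x * cartesian_character a y"
  by (simp add: cartesian_character_def cis_mult add_divide_distrib sum.distrib distrib_left)

lemma cartesian_character_lattice:
  assumes "x \<in> cartesian_lattice a"
  shows "cartesian_character a x = 1"
proof -
  have "of_int (x $ i) / of_int (a $ i) \<in> (\<int> :: real set)" for i
    using assms by (simp add: mem_cartesian_lattice_iff of_int_divide_in_Ints)
  then show ?thesis
    unfolding cartesian_character_def by (intro cis_multiple_2pi Ints_sum)
qed

lemma cartesian_character_axis_eq_1_iff:
  assumes "a $ j \<noteq> 0"
  shows "cartesian_character a (axis j b) = 1 \<longleftrightarrow> a $ j dvd b"
proof -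
  have "(\<Sum>i\<in>UNIV. of_int (axis j b $ i) / of_int (a $ i)) = (of_int b / of_int (a $ j) :: real)"
    by (subst sum.remove[of _ j]) (auto simp: axis_def)
  then have "cartesian_character a (axis j b) = 1
      \<longleftrightarrow> (\<exists>n. 2 * pi * (of_int b / of_int (a $ j)) = of_int n * (2 * pi))"
    by (simp only: cartesian_character_def cis_eq_1_iff)
  also have "\<dots> \<longleftrightarrow> (\<exists>n. of_int b = (of_int (a $ j * n) :: real))"
    using assms by (simp add: field_simps)
  also have "\<dots> \<longleftrightarrow> a $ j dvd b"
    unfolding of_int_eq_iff dvd_def ..
  finally show ?thesis .
qed

theorem cartesian_coset_partition_differences_dvd:
  fixes T :: "'i \<Rightarrow> (int ^ 'd) set" and v a :: "'i \<Rightarrow> int ^ 'd"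
  assumes partition: "finite I" "disjoint_family_on T I" "(\<Union>k\<in>I. T k) = UNIV"
    and m: "m \<in> I" "I \<noteq> {m}"
    and pos: "\<And>i. a m $ i > 0"
    and T: "\<And>k. k \<in> I \<Longrightarrow> T k = (+) (v k) ` cartesian_lattice (a k)"
  shows "\<exists>k\<in>I - {m}. \<forall>i. a m $ i dvd a k $ i"
proof (rule ccontr)
  assume "\<not> ?thesis"
  then obtain j where j: "\<And>k. k \<in> I - {m} \<Longrightarrow> \<not> a m $ j k dvd a k $ j k"
    by metis
  have "\<exists>k\<in>I - {m}. cartesian_character (a m) (axis (j k) (a k $ j k)) = 1"
  proof (rule partition_character_trivial_on_some_period[where \<psi> = "cartesian_character (a m)",
        OF partition m cartesian_character_add cartesian_character_0])
    show "cartesian_character (a m) t = cartesian_character (a m) (v m)" if "t \<in> T m" for t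
      using that T[OF m(1)] by (auto simp: cartesian_character_add cartesian_character_lattice)
    show "finite (fundamental_box (a m))"
      by (rule finite_fundamental_box)
    show "\<exists>!r. r \<in> fundamental_box (a m) \<and> x - r \<in> T m" for x
      unfolding T[OF m(1)] by (rule fundamental_box_transversal[OF pos])
    show "x + axis (j k) (a k $ j k) \<in> T k \<longleftrightarrow> x \<in> T k" if "k \<in> I - {m}" for k x
      using that T by (simp add: add_axis_mem_translate_cartesian_lattice_iff)
  qed
  then obtain k where "k \<in> I - {m}" "cartesian_character (a m) (axis (j k) (a k $ j k)) = 1"
    by blast
  moreover have "a m $ j k \<noteq> 0"
    using pos[of "j k"] by simp
  ultimately show False
    using j by (simp add: cartesian_character_axis_eq_1_iff)
qed

corollary cartesian_coset_partition_equal_differences: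
  fixes T :: "'i \<Rightarrow> (int ^ 'd) set" and v a :: "'i \<Rightarrow> int ^ 'd"
  assumes partition: "finite I" "disjoint_family_on T I" "(\<Union>k\<in>I. T k) = UNIV"
    and card: "card I \<ge> 2"
    and pos: "\<And>k i. k \<in> I \<Longrightarrow> a k $ i > 0"
    and T: "\<And>k. k \<in> I \<Longrightarrow> T k = (+) (v k) ` cartesian_lattice (a k)"
  shows "\<exists>k\<in>I. \<exists>l\<in>I. k \<noteq> l \<and> a k = a l"
proof -
  have "a ` I \<noteq> {}"
    using card by auto
  then obtain m where m: "m \<in> I" and maximal: "\<forall>b\<in>a ` I. a m \<le> b \<longrightarrow> a m = b"
    using finite_has_maximal[of "a ` I"] partition(1) by blast
  have "I \<noteq> {m}"
    using card by auto
  with partition m have "\<exists>k\<in>I - {m}. \<forall>i. a m $ i dvd a k $ i"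
    using pos[OF m] T by (rule cartesian_coset_partition_differences_dvd)
  then obtain k where k: "k \<in> I - {m}" and "\<forall>i. a m $ i dvd a k $ i"
    by blast
  then have "a m \<le> a k"
    using pos[of k] by (simp add: less_eq_vec_def zdvd_imp_le)
  then have "a m = a k"
    using maximal k by simp
  then show ?thesis
    using m k by force
qed

corollary cartesian_coset_partition_translates:
  fixes T :: "'i \<Rightarrow> (int ^ 'd) set"
  assumes partition: "finite I" "disjoint_family_on T I" "(\<Union>k\<in>I. T k) = UNIV"
    and card: "card I \<ge> 2"
    and coset: "\<And>k. k \<in> I \<Longrightarrow> cartesian_coset (T k)"
  shows "\<exists>k\<in>I. \<exists>l\<in>I. k \<noteq> l \<and> is_translate (T k) (T l)"
proof -
  obtain v a where pos: "\<And>k i. k \<in> I \<Longrightarrow> a k $ i > 0"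
    and T: "\<And>k. k \<in> I \<Longrightarrow> T k = (+) (v k) ` cartesian_lattice (a k)"
    using coset unfolding cartesian_coset_def by metis
  obtain k l where kl: "k \<in> I" "l \<in> I" "k \<noteq> l" "a k = a l"
    using cartesian_coset_partition_equal_differences[OF partition card pos T] by blast
  then have "T l = (+) (v l - v k) ` T k"
    by (simp add: T image_image)
  then show ?thesis
    using kl unfolding is_translate_def by blast
qed

theorem mainTheorem1:
  shows "\<not> (\<exists>\<T> :: (int ^ 'd) set set.
            tiling \<T> UNIV \<and> (\<forall>T\<in>\<T>. cartesian_coset T) \<and>
            (\<forall>T\<in>\<T>. \<forall>T'\<in>\<T>. T \<noteq> T' \<longrightarrow> \<not> is_translate T T'))
       \<and> (\<forall>(n::nat) (T :: nat \<Rightarrow> (int ^ 'd) set).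
            n \<ge> 2 \<and> (\<forall>i\<in>{1..n}. cartesian_coset (T i)) \<and>
            disjoint_family_on T {1..n} \<and> (\<Union>i\<in>{1..n}. T i) = UNIV \<longrightarrow>
            (\<exists>i\<in>{1..n}. \<exists>j\<in>{1..n}. i \<noteq> j \<and> is_translate (T i) (T j)))"
proof (intro conjI allI impI notI; elim exE conjE)
  fix \<T> :: "(int ^ 'd) set set"
  assume \<T>: "tiling \<T> UNIV" "\<forall>T\<in>\<T>. cartesian_coset T"
    and no_translates: "\<forall>T\<in>\<T>. \<forall>T'\<in>\<T>. T \<noteq> T' \<longrightarrow> \<not> is_translate T T'"
  have "disjoint_family_on (\<lambda>T. T) \<T>"
    using \<T>(1) by (simp add: tiling_def disjoint_family_on_def disjoint_def)
  then have "\<exists>T\<in>\<T>. \<exists>T'\<in>\<T>. T \<noteq> T' \<and> is_translate T T'"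
    using \<T> by (intro cartesian_coset_partition_translates) (simp_all add: tiling_def)
  with no_translates show False
    by metis
next
  fix n :: nat and T :: "nat \<Rightarrow> (int ^ 'd) set"
  assume "n \<ge> 2" "\<forall>i\<in>{1..n}. cartesian_coset (T i)"
    "disjoint_family_on T {1..n}" "(\<Union>i\<in>{1..n}. T i) = UNIV"
  then show "\<exists>i\<in>{1..n}. \<exists>j\<in>{1..n}. i \<noteq> j \<and> is_translate (T i) (T j)"
    by (intro cartesian_coset_partition_translates) simp_all
qed

end
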